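(* Let $\mathcal{A}$ be a subset of $4\mathbb{Z}^+$ containing $4$ and $8$, and let $\Psi_{\mathcal{A}} \subseteq \mathrm{GL}(2,\mathbb{Z})$ be the semigroup corresponding to continued fractions built from this alphabet, i.e. \[ \Psi_\mathcal{A} = \left\langle \begin{pmatrix} 0 & 1\\ 1 & a\end{pmatrix} : a \in \mathcal{A} \right\rangle^+. \] Then $\Psi_{\mathcal{A}}\begin{pmatrix} x\\ y\end{pmatrix}$ exhibits reciprocity obstructions in the denominator if $y\equiv 1\pmod{4}$, $x$ is odd, and $\left(\frac{x}{y}\right)=-1$.
   Context: $\left(\frac{x}{y}\right)$ denotes the Kronecker symbol; $\langle\cdots\rangle^+$ denotes the monoid generated (including the identity). For $\begin{pmatrix} u\\ v\end{pmatrix}$ in the orbit $\Psi_\mathcal{A}\begin{pmatrix} x\\ y\end{pmatrix}$, $v$ is the denominator. Reciprocity obstruction in the denominator means: the set of denominators contains squares modulo every $n\ge 1$, but contains no integer squares. *)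

theory Defs
  imports
    "HOL-Analysis.Analysis"
    "HOL-Number_Theory.Number_Theory"
    "HOL-Computational_Algebra.Nth_Powers"
begin

definition kronecker_prime :: "int \<Rightarrow> int \<Rightarrow> int" where
  "kronecker_prime a p =
    (if p = 2 then (if even a then 0 else if a mod 8 \<in> {1, 7} then 1 else -1)
     else Legendre a p)"

text \<open>
  The Kronecker symbol of \<open>a\<close> over an arbitrary integer \<open>n = u \<cdot> \<Prod>p\<close> with unit \<open>u\<close>.
  The factorization consists of positive primes whatever the sign of \<open>n\<close>, so the
  factor for \<open>u = -1\<close>, which is \<open>-1\<close> exactly when \<open>a < 0\<close>, is supplied separately.
\<close>

definition kronecker :: "int \<Rightarrow> int \<Rightarrow> int" where
  "kronecker a n =
    (if n = 0 then (if \<bar>a\<bar> = 1 then 1 else 0)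
     else (if n < 0 \<and> a < 0 then -1 else 1) *
          (\<Prod>p\<in>#prime_factorization n. kronecker_prime a p))"

inductive_set generated_monoid :: "('a::semiring_1^'n^'n) set \<Rightarrow> ('a^'n^'n) set"
  for S :: "('a^'n^'n) set" where
  one: "mat 1 \<in> generated_monoid S"
| gen: "g \<in> S \<Longrightarrow> g \<in> generated_monoid S"
| mult: "g \<in> generated_monoid S \<Longrightarrow> h \<in> generated_monoid S \<Longrightarrow> g ** h \<in> generated_monoid S"

definition cf_matrix :: "int \<Rightarrow> int^2^2" where
  "cf_matrix a = vector [vector [0, 1], vector [1, a]]"

definition cf_semigroup :: "int set \<Rightarrow> (int^2^2) set" where
  "cf_semigroup A = generated_monoid (cf_matrix ` A)"

lemma invertible_cf_semigroup:
  assumes "M \<in> cf_semigroup A"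
  shows "invertible M"
  using assms unfolding cf_semigroup_def
proof induction
  case one
  show ?case by (auto simp: invertible_def intro!: exI[of _ "mat 1"])
next
  case (gen g)
  then obtain a where g: "g = cf_matrix a" by auto
  let ?h = "vector [vector [- a, 1], vector [1, 0]] :: int^2^2"
  have "g ** ?h = mat 1" "?h ** g = mat 1"
    by (simp_all add: g cf_matrix_def matrix_matrix_mult_def mat_def vec_eq_iff forall_2 sum_2)
  then show ?case by (auto simp: invertible_def)
next
  case (mult g h)
  then show ?case by (simp add: invertible_mult)
qed

definition orbit_of :: "(int^2^2) set \<Rightarrow> int^2 \<Rightarrow> (int^2) set" where
  "orbit_of G w = (\<lambda>M. M *v w) ` G"

definition denominators :: "(int^2) set \<Rightarrow> int set" where
  "denominators X = (\<lambda>w. w $ 2) ` X"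

definition reciprocity_obstruction_in_denominator :: "(int^2) set \<Rightarrow> bool" where
  "reciprocity_obstruction_in_denominator X \<longleftrightarrow>
     (\<forall>n::nat. n \<ge> 1 \<longrightarrow> (\<exists>v\<in>denominators X. QuadRes (int n) v)) \<and>
     \<not> (\<exists>v\<in>denominators X. is_square v)"

end

(*
  Quadratic reciprocity shows that a step (x, y) -> (y, x + a y) with 4 | a keeps the Jacobi symbol
  of x over |y| equal to -1 as long as one of x, y is 1 mod 4 and they are not both negative; a square
  denominator would make the symbol nonnegative, and two negative entries never become positive again.
  Modulo n there is no such obstruction: the generators for 4 and 8 become invertible, and the products
  g_4^-1 g_8 and g_8 g_4^-1 are the elementary matrices with off-diagonal entry 4. One of them moves x
  to a unit modulo n, and the other then moves y, which is 1 mod 4, to 1.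
*)
theory Submission
  imports Defs
begin

subsection \<open>The Jacobi symbol\<close>

lemma euler_criterion_int:
  assumes "prime p" and "odd (p::int)"
  shows "[Legendre a p = a ^ ((nat p - 1) div 2)] (mod p)"
proof -
  have "p > 2"
    using assms prime_ge_2_int[of p] by (cases "p = 2") auto
  then show ?thesis
    using euler_criterion[of "nat p" a] assms by (simp add: prime_nat_iff_prime)
qed

lemma Legendre_cases: "Legendre a p \<in> {-1, 0, 1}"
  by (auto simp: Legendre_def)

text \<open>Two such values differ by at most 2, which is less than \<open>p\<close>. This turns
  congruences from Euler's criterion into equations.\<close>

lemma eq_of_cong_prime:
  assumes "odd (p::int)" "prime p" and "[s = t] (mod p)" "s \<in> {-1, 0, 1}" "t \<in> {-1, 0, 1}"
  shows "s = t"
proof -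
  have "p > 2"
    using assms prime_ge_2_int[of p] by (cases "p = 2") auto
  moreover have "p dvd s - t"
    using assms by (simp add: cong_iff_dvd_diff)
  ultimately show ?thesis
    using assms(4,5) zdvd_imp_le[of p "s - t"] zdvd_imp_le[of p "t - s"]
    by (auto simp: dvd_diff_commute)
qed

lemma Legendre_mult:
  assumes "prime p" and "odd (p::int)"
  shows "Legendre (a * b) p = Legendre a p * Legendre b p"
proof (rule eq_of_cong_prime[OF assms(2,1)])
  show "[Legendre (a * b) p = Legendre a p * Legendre b p] (mod p)"
    using euler_criterion_int[OF assms, of "a * b"]
      cong_mult[OF euler_criterion_int[OF assms, of a] euler_criterion_int[OF assms, of b]]
    by (metis cong_sym cong_trans power_mult_distrib)
  show "Legendre (a * b) p \<in> {-1, 0, 1}" by (rule Legendre_cases)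
  show "Legendre a p * Legendre b p \<in> {-1, 0, 1}"
    using Legendre_cases[of a p] Legendre_cases[of b p] by auto
qed

lemma Legendre_cong: "[a = b] (mod p) \<Longrightarrow> Legendre a p = Legendre b p"
  unfolding Legendre_def QuadRes_def by (simp add: cong_def)

text \<open>Converts the exponents in Euler's criterion and in quadratic reciprocity into residues
  modulo 4.\<close>

lemma even_half_iff:
  assumes "odd (p::int)" "p > 0"
  shows "even ((nat p - 1) div 2) \<longleftrightarrow> p mod 4 = 1"
proof -
  obtain k where k: "p = 2 * k + 1" using assms(1) by (auto elim: oddE)
  then have "k \<ge> 0" using assms(2) by simp
  then obtain m where m: "k = int m" by (metis nonneg_int_cases)
  have "(nat p - 1) div 2 = m" using k m by simp
  moreover have "(2 * int m + 1) mod 4 = 1 \<longleftrightarrow> even m" by presburger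
  ultimately show ?thesis using k m by simp
qed

lemma Legendre_neg1:
  assumes "prime p" and "odd (p::int)"
  shows "Legendre (-1) p = (if p mod 4 = 1 then 1 else -1)"
proof (rule eq_of_cong_prime[OF assms(2,1)])
  show "[Legendre (-1) p = (if p mod 4 = 1 then 1 else -1)] (mod p)"
    using euler_criterion_int[OF assms, of "-1"] even_half_iff[OF assms(2) prime_gt_0_int[OF assms(1)]]
    by (cases "p mod 4 = 1") simp_all
qed (use Legendre_cases in auto)

text \<open>For odd positive \<open>m\<close> and \<open>n\<close> this is (-1)^((m-1)/2 * (n-1)/2),
  the sign in the reciprocity law.\<close>

definition recip_sign :: "int \<Rightarrow> int \<Rightarrow> int" where
  "recip_sign m n = (if m mod 4 = 3 \<and> n mod 4 = 3 then -1 else 1)"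

lemma recip_sign_commute: "recip_sign m n = recip_sign n m"
  by (auto simp: recip_sign_def)

lemma odd_mod_4: "odd (m::int) \<Longrightarrow> m mod 4 = 1 \<or> m mod 4 = 3"
  by presburger

lemma recip_sign_mult:
  assumes "odd m" "odd m'"
  shows "recip_sign (m * m') n = recip_sign m n * recip_sign m' n"
  using odd_mod_4[OF assms(1)] odd_mod_4[OF assms(2)] mod_mult_eq[of m 4 m']
  by (auto simp: recip_sign_def)

text \<open>For \<open>p = q\<close> both symbols vanish, so this form, unlike the one with the
  product of the symbols, holds without distinctness and fits inductions over prime factors.\<close>

lemma Legendre_reciprocity:
  assumes "prime p" "odd (p::int)" "prime q" "odd (q::int)"
  shows "Legendre p q = recip_sign p q * Legendre q p"
proof (cases "p = q")
  case True
  then show ?thesis by (simp add: Legendre_def cong_iff_dvd_diff)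
next
  case False
  have gt: "p > 2" "q > 2"
    using assms prime_ge_2_int[of p] prime_ge_2_int[of q] by (cases "p = 2"; cases "q = 2"; auto)+
  have "Legendre p q * Legendre q p
      = (-1) ^ ((nat p - 1) div 2 * ((nat q - 1) div 2))"
    using Quadratic_Reciprocity[of "nat p" "nat q"] False gt assms
    by (auto simp: prime_nat_iff_prime eq_nat_nat_iff)
  also have "\<dots> = recip_sign p q"
    using even_half_iff[of p] even_half_iff[of q] gt assms odd_mod_4[of p] odd_mod_4[of q]
    by (auto simp: recip_sign_def uminus_power_if)
  finally show ?thesis
    using Legendre_cases[of p q] Legendre_cases[of q p] by (auto simp: recip_sign_def split: if_splits)
qed

text \<open>The product below runs over the positive prime factors, so that this is the symbol of
  \<open>a\<close> over \<open>\<bar>n\<bar>\<close> for odd \<open>n\<close>; it differs from the Kronecker symbol by a sign if \<open>a, n < 0\<close>.\<close>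

definition jacobi :: "int \<Rightarrow> int \<Rightarrow> int" where
  "jacobi a n = (\<Prod>p\<in>#prime_factorization n. Legendre a p)"

lemma odd_prime_factor: "odd (n::int) \<Longrightarrow> p \<in># prime_factorization n \<Longrightarrow> prime p \<and> odd p"
  by (metis dvd_trans in_prime_factors_imp_dvd in_prime_factors_imp_prime)

text \<open>An odd \<open>n\<close> lacks the prime factor 2, the only prime where
  \<open>kronecker_prime\<close> is not defined as \<open>Legendre\<close>.\<close>

lemma kronecker_eq_jacobi:
  assumes "odd n"
  shows "kronecker a n = (if n < 0 \<and> a < 0 then -1 else 1) * jacobi a n"
proof -
  have "(\<Prod>p\<in>#prime_factorization n. kronecker_prime a p) = jacobi a n"
    unfolding jacobi_def using odd_prime_factor[OF assms]
    by (intro arg_cong[of _ _ prod_mset] image_mset_cong) (force simp: kronecker_prime_def)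
  with assms show ?thesis by (auto simp: kronecker_def)
qed

lemma jacobi_minus_right [simp]: "jacobi a (- n) = jacobi a n"
  using prime_factorization_normalize[of "- n"] prime_factorization_normalize[of n]
  by (simp add: jacobi_def)

lemma jacobi_1_right [simp]: "jacobi a 1 = 1"
  by (simp add: jacobi_def)

lemma jacobi_prime: "prime p \<Longrightarrow> jacobi a p = Legendre a p"
  by (simp add: jacobi_def prime_factorization_prime)

lemma jacobi_mult_right: "m \<noteq> 0 \<Longrightarrow> n \<noteq> 0 \<Longrightarrow> jacobi a (m * n) = jacobi a m * jacobi a n"
  by (simp add: jacobi_def prime_factorization_mult)

lemma jacobi_mult_left:
  assumes "odd n"
  shows "jacobi (a * b) n = jacobi a n * jacobi b n"
proof -
  have "jacobi (a * b) n = (\<Prod>p\<in>#prime_factorization n. Legendre a p * Legendre b p)"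
    unfolding jacobi_def using odd_prime_factor[OF assms]
    by (intro arg_cong[of _ _ prod_mset] image_mset_cong) (simp add: Legendre_mult)
  then show ?thesis by (simp add: jacobi_def prod_mset.distrib)
qed

lemma jacobi_cong:
  assumes "[a = b] (mod n)"
  shows "jacobi a n = jacobi b n"
  unfolding jacobi_def using assms
  by (intro arg_cong[of _ _ prod_mset] image_mset_cong Legendre_cong)
     (blast intro: cong_dvd_modulus in_prime_factors_imp_dvd)

text \<open>Oddness and positivity pass to the cofactor of a prime, so the induction stays within
  the range of the reciprocity law.\<close>

lemma odd_pos_int_induct [consumes 2, case_names one prime_mult]:
  assumes "odd (n::int)" "n > 0"
    and "P 1" "\<And>p m. prime p \<Longrightarrow> odd p \<Longrightarrow> odd m \<Longrightarrow> m > 0 \<Longrightarrow> P m \<Longrightarrow> P (p * m)"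
  shows "P n"
  using assms(1,2)
proof (induction n rule: prime_divisors_induct)
  case (unit x)
  then show ?case using assms(3) by (auto simp: zdvd1_eq)
next
  case (factor p x)
  moreover have "x > 0"
    using factor.prems(2) prime_gt_0_int[OF factor.hyps(1)] by (simp add: zero_less_mult_iff)
  ultimately show ?case using assms(4)[of p x] by simp
qed simp

lemma jacobi_1_left [simp]: "jacobi 1 n = 1"
proof -
  have "Legendre 1 p = 1" if "p \<in># prime_factorization n" for p
    using that not_prime_unit[of p] in_prime_factors_imp_prime[OF that]
    by (auto simp: Legendre_def QuadRes_def cong_iff_dvd_diff intro: exI[of _ 1])
  then have "image_mset (Legendre 1) (prime_factorization n) = image_mset (\<lambda>_. 1) (prime_factorization n)"
    by (intro image_mset_cong)
  then show ?thesis by (simp add: jacobi_def)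
qed

lemma jacobi_neg1:
  assumes "odd n" "n > 0"
  shows "jacobi (-1) n = (if n mod 4 = 1 then 1 else -1)"
  using assms
proof (induction n rule: odd_pos_int_induct)
  case (prime_mult p m)
  then have "jacobi (-1) (p * m) = (if p mod 4 = 1 then 1 else -1) * (if m mod 4 = 1 then 1 else -1)"
    by (subst jacobi_mult_right) (auto simp: jacobi_prime Legendre_neg1)
  then show ?case
    using odd_mod_4[OF prime_mult(2)] odd_mod_4[OF prime_mult(3)] mod_mult_eq[of p 4 m] by auto
qed simp

text \<open>Both sides are multiplicative in \<open>n\<close>. Reciprocity is extended to composite
  numbers one argument at a time, and \<open>p\<close> stays prime here.\<close>

lemma jacobi_prime_reciprocity:
  assumes "prime p" "odd p" "odd n" "n > 0"
  shows "jacobi p n = recip_sign p n * jacobi n p"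
  using assms(3,4)
proof (induction n rule: odd_pos_int_induct)
  case one
  then show ?case by (simp add: recip_sign_def)
next
  case (prime_mult q m)
  have "jacobi p (q * m) = Legendre p q * jacobi p m"
    using prime_mult by (subst jacobi_mult_right) (auto simp: jacobi_prime)
  also have "\<dots> = recip_sign p q * Legendre q p * (recip_sign p m * jacobi m p)"
    using Legendre_reciprocity[OF assms(1,2) prime_mult(1,2)] prime_mult by simp
  also have "\<dots> = recip_sign p (q * m) * jacobi (q * m) p"
    using recip_sign_mult[OF prime_mult(2,3), of p] assms(1,2)
    by (simp add: recip_sign_commute[of p] jacobi_mult_left jacobi_prime Legendre_mult)
  finally show ?case .
qed

lemma jacobi_reciprocity:
  assumes "odd m" "m > 0" "odd n" "n > 0"
  shows "jacobi m n = recip_sign m n * jacobi n m"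
  using assms(1,2)
proof (induction m rule: odd_pos_int_induct)
  case one
  then show ?case by (simp add: recip_sign_def)
next
  case (prime_mult p m)
  have "jacobi (p * m) n = jacobi p n * jacobi m n"
    using assms by (simp add: jacobi_mult_left)
  also have "\<dots> = recip_sign p n * jacobi n p * (recip_sign m n * jacobi n m)"
    using jacobi_prime_reciprocity[of p n] prime_mult assms by simp
  also have "\<dots> = recip_sign (p * m) n * jacobi n (p * m)"
    using prime_mult by (subst jacobi_mult_right) (auto simp: recip_sign_mult)
  finally show ?case .
qed

lemma jacobi_swap_mixed_signs:
  assumes "odd u" "odd v" "u mod 4 = 1 \<or> v mod 4 = 1" "u > 0" "v < 0"
  shows "jacobi u v = jacobi v u"
proof -
  have "jacobi u v = recip_sign u (- v) * jacobi (- v) u"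
    using jacobi_reciprocity[of u "- v"] assms by simp
  also have "\<dots> = recip_sign u (- v) * (jacobi (-1) u * jacobi v u)"
    using jacobi_mult_left[of u "-1" v] assms by simp
  \<comment> \<open>Both are 1 if \<open>u mod 4 = 1\<close>; otherwise \<open>v mod 4 = 1\<close>,
    so \<open>- v\<close> is 3 modulo 4 and both are -1. The two signs then cancel.\<close>
  also have "recip_sign u (- v) = jacobi (-1) u"
  proof -
    have "v mod 4 = 1 \<Longrightarrow> - v mod 4 = 3" by presburger
    then show ?thesis
      using assms odd_mod_4[of u] by (auto simp: jacobi_neg1 recip_sign_def)
  qed
  finally show ?thesis
    using assms by (auto simp: jacobi_neg1 split: if_splits)
qed

text \<open>Two negative entries have to be excluded: for \<open>u = -3\<close> and
  \<open>v = -1\<close> the two sides are 1 and -1.\<close>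

lemma jacobi_swap:
  assumes "odd u" "odd v" "u mod 4 = 1 \<or> v mod 4 = 1" "\<not> (u < 0 \<and> v < 0)"
  shows "jacobi u v = jacobi v u"
proof -
  have "u \<noteq> 0" "v \<noteq> 0" using assms by auto
  then consider "u > 0" "v > 0" | "u > 0" "v < 0" | "u < 0" "v > 0"
    using assms(4) by linarith
  then show ?thesis
  proof cases
    case 1
    then show ?thesis using jacobi_reciprocity[of u v] assms by (auto simp: recip_sign_def)
  next
    case 2
    then show ?thesis using jacobi_swap_mixed_signs assms by blast
  next
    case 3
    then show ?thesis using jacobi_swap_mixed_signs[of v u] assms by auto
  qed
qed

lemma jacobi_square_right_nonneg: "odd n \<Longrightarrow> jacobi a (n ^ 2) \<ge> 0"
  by (cases "n = 0") (simp_all add: power2_eq_square jacobi_mult_right)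

text \<open>A common prime factor contributes a vanishing Legendre symbol to the product.\<close>

lemma coprime_of_jacobi_nonzero:
  assumes "odd n" "jacobi a n \<noteq> 0"
  shows "coprime a n"
proof (rule ccontr)
  assume "\<not> coprime a n"
  moreover have "gcd a n \<noteq> 0" using assms(1) by auto
  ultimately obtain p where p: "prime p" "p dvd gcd a n"
    using prime_divisor_exists[of "gcd a n"] by (auto simp: coprime_iff_gcd_eq_1)
  then have "p \<in># prime_factorization n" "Legendre a p = 0"
    using assms(1) by (auto simp: in_prime_factors_iff Legendre_def cong_0_iff)
  then show False using assms(2) by (auto simp: jacobi_def prod_mset_zero_iff)
qed

subsection \<open>Denominators are never squares\<close>

lemma cf_matrix_mult_vec [simp]:
  "(cf_matrix a *v w) $ 1 = w $ 2" "(cf_matrix a *v w) $ 2 = w $ 1 + a * w $ 2"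
  by (simp_all add: cf_matrix_def matrix_vector_mult_def sum_2)

text \<open>If both entries are negative then all further denominators are negative, whatever the
  value of the symbol; this is also where it differs from the Kronecker symbol.\<close>

definition obstructed :: "int^2 \<Rightarrow> bool" where
  "obstructed w \<longleftrightarrow> odd (w $ 1) \<and> odd (w $ 2) \<and> (w $ 1 mod 4 = 1 \<or> w $ 2 mod 4 = 1) \<and>
     (w $ 1 < 0 \<and> w $ 2 < 0 \<or> jacobi (w $ 1) (w $ 2) = -1)"

text \<open>The new entry \<open>z\<close> is congruent to \<open>x\<close> both modulo 4 and modulo
  \<open>y\<close>, so swapping the arguments leads from the symbol of \<open>y\<close> over
  \<open>z\<close> back to that of \<open>x\<close> over \<open>y\<close>.\<close>

lemma obstructed_step:
  assumes "obstructed w" "4 dvd a" "a > 0"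
  shows "obstructed (cf_matrix a *v w)"
proof -
  define x y z where "x = w $ 1" and "y = w $ 2" and "z = x + a * y"
  have xy: "odd x" "odd y" "x mod 4 = 1 \<or> y mod 4 = 1" "x < 0 \<and> y < 0 \<or> jacobi x y = -1"
    using assms(1) by (auto simp: obstructed_def x_def y_def)
  have z4: "z mod 4 = x mod 4"
    using assms(2) by (auto simp: z_def mult.assoc elim!: dvdE)
  then have z: "odd z" using xy(1) by presburger
  have "y < 0 \<and> z < 0 \<or> jacobi y z = -1"
  proof (cases "y < 0 \<and> z < 0")
    case False
    \<comment> \<open>As \<open>a > 0\<close>, negative \<open>x\<close> and \<open>y\<close> would
      force \<open>z < 0\<close>, which this case excludes.\<close>
    then have "\<not> (x < 0 \<and> y < 0)"
      using assms(3) mult_pos_neg[of a y] by (auto simp: z_def)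
    moreover have "jacobi y z = jacobi z y"
      using jacobi_swap[of y z] xy z z4 False by auto
    moreover have "jacobi z y = jacobi x y"
      by (rule jacobi_cong) (simp add: z_def cong_iff_dvd_diff)
    ultimately show ?thesis using xy by metis
  qed simp
  then show ?thesis
    using xy z z4 by (auto simp: obstructed_def x_def y_def z_def)
qed

lemma obstructed_cf_semigroup:
  assumes "A \<subseteq> {4 * k | k. k > 0}" "M \<in> cf_semigroup A" "obstructed w"
  shows "obstructed (M *v w)"
  using assms(2,3) unfolding cf_semigroup_def
proof (induction arbitrary: w)
  case (gen g)
  then show ?case using assms(1) obstructed_step by fastforce
next
  case (mult g h)
  then show ?case by (simp flip: matrix_vector_mul_assoc)
qed simp

lemma obstructed_not_square:
  assumes "obstructed w"
  shows "\<not> is_square (w $ 2)"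
proof
  assume "is_square (w $ 2)"
  then obtain s where s: "w $ 2 = s ^ 2" by (auto elim: is_nth_powerE)
  then have "odd s" using assms by (simp add: obstructed_def)
  then show False
    using assms s jacobi_square_right_nonneg[of s "w $ 1"] zero_le_power2[of s]
    by (auto simp: obstructed_def)
qed

subsection \<open>Denominators modulo \<open>n\<close>\<close>

definition vec_cong :: "int \<Rightarrow> int^2 \<Rightarrow> int^2 \<Rightarrow> bool" where
  "vec_cong n v w \<longleftrightarrow> [v $ 1 = w $ 1] (mod n) \<and> [v $ 2 = w $ 2] (mod n)"

lemma vec_cong_trans: "vec_cong n u v \<Longrightarrow> vec_cong n v w \<Longrightarrow> vec_cong n u w"
  by (auto simp: vec_cong_def intro: cong_trans)

lemma vec_cong_mult: "vec_cong n v w \<Longrightarrow> vec_cong n (M *v v) (M *v w)"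
  by (simp add: vec_cong_def matrix_vector_mult_def sum_2 cong_add cong_scalar_left)

text \<open>Asking only for congruence of the endpoint is what allows steps of generators to be
  undone.\<close>

definition reaches :: "int set \<Rightarrow> int \<Rightarrow> int^2 \<Rightarrow> int^2 \<Rightarrow> bool" where
  "reaches A n v w \<longleftrightarrow> (\<exists>M\<in>cf_semigroup A. vec_cong n (M *v v) w)"

lemma reaches_cong: "vec_cong n v w \<Longrightarrow> reaches A n v w"
  unfolding reaches_def cf_semigroup_def
  by (rule bexI[of _ "mat 1"]) (simp_all add: generated_monoid.one)

lemma reaches_gen: "a \<in> A \<Longrightarrow> reaches A n v (cf_matrix a *v v)"
  unfolding reaches_def cf_semigroup_def
  by (rule bexI[of _ "cf_matrix a"]) (simp_all add: generated_monoid.gen vec_cong_def)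

lemma reaches_trans:
  assumes "reaches A n u v" "reaches A n v w"
  shows "reaches A n u w"
proof -
  obtain M N where "M \<in> cf_semigroup A" "vec_cong n (M *v u) v"
    and "N \<in> cf_semigroup A" "vec_cong n (N *v v) w"
    using assms by (auto simp: reaches_def)
  then have "N ** M \<in> cf_semigroup A" "vec_cong n ((N ** M) *v u) w"
    by (auto simp: cf_semigroup_def generated_monoid.mult
        simp flip: matrix_vector_mul_assoc intro: vec_cong_mult vec_cong_trans)
  then show ?thesis by (auto simp: reaches_def)
qed

lemma vec_cong_cf_matrix_cancel:
  assumes "vec_cong n (cf_matrix a *v v) (cf_matrix a *v w)"
  shows "vec_cong n v w"
proof -
  have 2: "[v $ 2 = w $ 2] (mod n)" and "[v $ 1 + a * v $ 2 = w $ 1 + a * w $ 2] (mod n)"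
    using assms by (simp_all add: vec_cong_def)
  then have "[v $ 1 + a * v $ 2 - a * v $ 2 = w $ 1 + a * w $ 2 - a * w $ 2] (mod n)"
    by (intro cong_diff cong_scalar_left)
  with 2 show ?thesis by (simp add: vec_cong_def)
qed

text \<open>The residues mod \<open>n\<close> of the iterates repeat, and a generator acts injectively on residues,
  so its inverse is congruent to one of its powers.\<close>

lemma reaches_gen_inverse:
  assumes "n > 0" "a \<in> A"
  shows "reaches A n (cf_matrix a *v v) v"
proof -
  define f where "f = (*v) (cf_matrix a)"
  define res where "res k = (((f ^^ k) v) $ 1 mod n, ((f ^^ k) v) $ 2 mod n)" for k
  have "range res \<subseteq> {0..<n} \<times> {0..<n}"
    using assms(1) by (auto simp: res_def)
  then have "finite (range res)" by (rule finite_subset) simp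
  then have "\<not> inj res" using finite_imageD[of res UNIV] by auto
  then obtain i j where "i \<noteq> j" "res i = res j" by (auto simp: inj_def)
  \<comment> \<open>Writing the period as \<open>Suc d\<close> makes it positive: after one step,
    the other \<open>d\<close> steps lead back.\<close>
  then obtain i d where "res (i + Suc d) = res i"
  proof (induction i j rule: linorder_wlog)
    case (le i j)
    then show ?case using le(2)[of i "j - Suc i"] by simp
  qed metis
  then have "vec_cong n ((f ^^ (i + Suc d)) v) ((f ^^ i) v)"
    by (simp add: res_def vec_cong_def cong_def)
  then have "vec_cong n ((f ^^ Suc d) v) v"
  proof (induction i)
    case (Suc i)
    then show ?case unfolding f_def by (auto dest: vec_cong_cf_matrix_cancel)
  qed simp
  then have "reaches A n ((f ^^ d) (f v)) v"
    by (intro reaches_cong) (simp add: funpow_swap1)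
  moreover have "reaches A n u ((f ^^ k) u)" for k u
  proof (induction k)
    case 0
    show ?case by (simp add: reaches_cong vec_cong_def)
  next
    case (Suc k)
    then show ?case using reaches_trans reaches_gen[OF assms(2)] by (simp add: f_def)
  qed
  ultimately show ?thesis unfolding f_def by (blast intro: reaches_trans)
qed

text \<open>The first shear applies \<open>cf_matrix b\<close> and then undoes
  \<open>cf_matrix a\<close>; the second does these in the opposite order.\<close>

lemma reaches_shear:
  assumes "n > 0" "a \<in> A" "b \<in> A" "d = b - a"
  shows "reaches A n (vector [x, y]) (vector [x + int k * d * y, y])"
    and "reaches A n (vector [x, y]) (vector [x, y + int k * d * x])"
proof -
  have upper: "reaches A n (vector [x, y]) (vector [x + d * y, y])" for x y
  proof -
    have "cf_matrix b *v vector [x, y] = cf_matrix a *v vector [x + d * y, y]"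
      by (simp add: vec_eq_iff forall_2 assms(4) algebra_simps)
    then show ?thesis
      by (metis assms(1-3) reaches_gen reaches_gen_inverse reaches_trans)
  qed
  have lower: "reaches A n (vector [x, y]) (vector [x, y + d * x])" for x y
  proof -
    \<comment> \<open>\<open>vector [y - a * x, x]\<close> is what undoing
      \<open>cf_matrix a\<close> makes of \<open>vector [x, y]\<close>.\<close>
    have "cf_matrix a *v vector [y - a * x, x] = vector [x, y]"
      and "cf_matrix b *v vector [y - a * x, x] = vector [x, y + d * x]"
      by (simp_all add: vec_eq_iff forall_2 assms(4) algebra_simps)
    then show ?thesis
      by (metis assms(1-3) reaches_gen reaches_gen_inverse reaches_trans)
  qed
  show "reaches A n (vector [x, y]) (vector [x + int k * d * y, y])"
  proof (induction k)
    case (Suc k)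
    then show ?case
      using reaches_trans[OF _ upper] by (fastforce simp: algebra_simps)
  qed (simp add: reaches_cong vec_cong_def)
  show "reaches A n (vector [x, y]) (vector [x, y + int k * d * x])"
  proof (induction k)
    case (Suc k)
    then show ?case
      using reaches_trans[OF _ lower] by (fastforce simp: algebra_simps)
  qed (simp add: reaches_cong vec_cong_def)
qed

text \<open>Take for \<open>j\<close> the product of the primes that divide \<open>n\<close> but not
  \<open>x\<close>. Such a prime divides the shift but not \<open>x\<close>. A prime dividing both
  \<open>n\<close> and \<open>x\<close> is odd and divides neither \<open>y\<close> nor
  \<open>j\<close>, hence not the shift. So no prime divisor of \<open>n\<close> divides the
  sum.\<close>

lemma exists_coprime_shift:
  fixes x y n :: int
  assumes "coprime x y" "odd x" "n > 0"
  obtains j :: nat where "coprime (x + int j * 4 * y) n"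
proof
  define P where "P = {p. prime p \<and> p dvd nat n \<and> \<not> int p dvd x}"
  have "P \<subseteq> {..nat n}" using assms(3) by (auto simp: P_def dest: dvd_imp_le)
  then have fin: "finite P" by (rule finite_subset) simp
  define j where "j = \<Prod>P"
  show "coprime (x + int j * 4 * y) n"
  proof (rule ccontr)
    assume "\<not> coprime (x + int j * 4 * y) n"
    moreover have "gcd (x + int j * 4 * y) n \<noteq> 0" using assms(3) by auto
    ultimately obtain q where q: "prime q" "q dvd gcd (x + int j * 4 * y) n"
      using prime_divisor_exists[of "gcd (x + int j * 4 * y) n"] by (auto simp: coprime_iff_gcd_eq_1)
    then obtain p where p: "q = int p" "prime p"
      by (metis int_nat_eq prime_ge_0_int prime_nat_iff_prime nat_0_le)
    have pn: "p dvd nat n" and px: "int p dvd x + int j * 4 * y"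
      using q p assms(3) by (simp_all flip: int_dvd_int_iff)
    show False
    proof (cases "int p dvd x")
      case True
      then have "int p dvd int j * 4 * y" using px by (simp add: dvd_add_right_iff)
      moreover have "\<not> int p dvd y"
        using True assms(1) p(2) by (meson not_prime_unit coprime_common_divisor prime_nat_int_transfer)
      moreover have "\<not> int p dvd 4"
      proof
        assume "int p dvd 4"
        then have "int p dvd 2 * 2" by simp
        then have "int p dvd 2" using p(2) by (metis prime_dvd_mult_iff prime_nat_int_transfer)
        then have "p = 2" using p(2) by (metis int_dvd_int_iff of_nat_numeral primes_dvd_imp_eq two_is_prime_nat)
        then show False using True assms(2) by simp
      qed
      moreover have "\<not> p dvd j"
        using p(2) fin True unfolding j_def
        by (auto simp: prime_dvd_prod_iff P_def dest: primes_dvd_imp_eq)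
      ultimately show False
        using p(2) by (simp add: prime_dvd_mult_iff int_dvd_int_iff)
    next
      case False
      then have "p \<in> P" using pn p(2) by (simp add: P_def)
      then have "p dvd j" using dvd_prodI[OF fin, of p "\<lambda>p. p"] by (simp add: j_def)
      then have "int p dvd int j * 4 * y" by (simp add: int_dvd_int_iff)
      then show False using False px by (simp add: dvd_add_left_iff)
    qed
  qed
qed

lemma reaches_denominator_1:
  assumes "n > 0" "4 \<in> A" "8 \<in> A" "coprime x y" "odd x" "[y = 1] (mod 4)"
  obtains u where "reaches A n (vector [x, y]) (vector [u, 1])"
proof -
  obtain j where j: "coprime (x + int j * 4 * y) n"
    using exists_coprime_shift assms by blast
  define u where "u = x + int j * 4 * y"
  have shear: "reaches A n (vector [x, y]) (vector [u, y])"
    using reaches_shear(1)[OF assms(1-3), of 4] by (simp add: u_def)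
  obtain c where c: "[u * c = 1] (mod n)"
    using j cong_solve_coprime_int[of u n] by (auto simp: u_def)
  obtain m where m: "y = 1 + 4 * m"
    using assms(6) by (metis cong_iff_lin cong_sym)
  \<comment> \<open>Chosen so that \<open>int k * 4 * u\<close> is congruent to
    \<open>- 4 * m\<close>, which turns \<open>y = 1 + 4 * m\<close> into 1; reduction modulo
    \<open>n\<close> makes the multiplier a natural number.\<close>
  define k where "k = nat ((- m * c) mod n)"
  have "[int k = - m * c] (mod n)" using assms(1) by (simp add: k_def cong_def)
  then have "[y + int k * 4 * u = y + (- m * c) * 4 * u] (mod n)"
    by (intro cong_add cong_mult) simp_all
  also have "y + (- m * c) * 4 * u = y - 4 * m * (u * c)" by (simp add: algebra_simps)
  also have "[y - 4 * m * (u * c) = y - 4 * m * 1] (mod n)"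
    by (intro cong_diff cong_mult c) simp_all
  finally have "vec_cong n (vector [u, y + int k * 4 * u]) (vector [u, 1])"
    by (simp add: vec_cong_def m)
  moreover have "reaches A n (vector [u, y]) (vector [u, y + int k * 4 * u])"
    using reaches_shear(2)[OF assms(1-3), of 4] by simp
  ultimately show ?thesis
    using that shear by (blast intro: reaches_trans reaches_cong)
qed

theorem theorem2p17:
  fixes A :: "int set" and x y :: int
  assumes "A \<subseteq> {4 * k | k. k > 0}"
    and "4 \<in> A" and "8 \<in> A"
    and "[y = 1] (mod 4)"
    and "odd x"
    and "kronecker x y = -1"
  shows "reciprocity_obstruction_in_denominator (orbit_of (cf_semigroup A) (vector [x, y]))"
proof -
  have y4: "y mod 4 = 1" using assms(4) by (simp add: cong_def)
  then have y: "odd y" by presburger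
  have jac: "(if y < 0 \<and> x < 0 then -1 else 1) * jacobi x y = -1"
    using assms(6) kronecker_eq_jacobi[OF y] by simp
  then have cop: "coprime x y"
    using coprime_of_jacobi_nonzero[OF y, of x] by (cases "jacobi x y = 0") simp_all
  \<comment> \<open>If both entries are negative, the first alternative of \<open>obstructed\<close>
    holds; otherwise the sign factor in \<open>jac\<close> is 1 and the symbol itself is -1.\<close>
  have "obstructed (vector [x, y])"
    using y4 y assms(5) jac by (auto simp: obstructed_def split: if_splits)
  then have "\<not> is_square (v $ 2)" if "v \<in> orbit_of (cf_semigroup A) (vector [x, y])" for v
    using that assms(1) obstructed_cf_semigroup obstructed_not_square
    by (auto simp: orbit_of_def)
  moreover have "\<exists>v\<in>orbit_of (cf_semigroup A) (vector [x, y]). QuadRes (int n) (v $ 2)"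
    if "n \<ge> 1" for n :: nat
  proof -
    have "int n > 0" using that by simp
    \<comment> \<open>Since 1 is a square modulo every \<open>n\<close>, a denominator congruent to
      1 suffices.\<close>
    then obtain u where "reaches A (int n) (vector [x, y]) (vector [u, 1])"
      by (rule reaches_denominator_1) (use assms cop in simp_all)
    then obtain M where M: "M \<in> cf_semigroup A" "[(M *v vector [x, y]) $ 2 = 1] (mod int n)"
      by (auto simp: reaches_def vec_cong_def)
    then have "QuadRes (int n) ((M *v vector [x, y]) $ 2)"
      unfolding QuadRes_def by (intro exI[of _ 1]) (simp add: cong_sym)
    with M(1) show ?thesis by (auto simp: orbit_of_def)
  qed
  ultimately show ?thesis
    by (auto simp: reciprocity_obstruction_in_denominator_def denominators_def)
qed

end
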